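(* Let $a<b$ be real numbers, let $I=[a,b]$, let $g:I\to\mathbb{R}$ be Riemann integrable on $I$, let $c\in\mathbb{R}$, and let $G(t)=c+\int_a^t g(s)\,ds$ for all $t\in I$. If $f:G(I)\to\mathbb{R}$ is bounded on $G(I)$, then $f$ is Riemann integrable on $G(I)$ if and only if $(f\circ G)\,g$ is Riemann integrable on $I$, and, in that case, $$\int_{G(a)}^{G(b)} f(x)\,dx=\int_a^b f(G(t))\,g(t)\,dt.$$
   Context: All integrals and integrability are in the Riemann sense. Since $G$ is continuous, $G(I)$ is a compact interval, possibly reduced to a single point. By convention, if $G(I)$ is a single point (i.e. $G$ is constant), every function on $G(I)$ is regarded as Riemann integrable, and $\int_p^p f(x)\,dx=0$. When $G(b)<G(a)$, $\int_{G(a)}^{G(b)}f(x)\,dx=-\int_{G(b)}^{G(a)}f(x)\,dx$ as usual. *)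

theory Defs
  imports "HOL-Analysis.Analysis"
begin

hide_const (open) Polynomial.content

text \<open>
  The integral of \<open>HOL-Analysis\<close> is the gauge integral. The Riemann integral is defined here as
  the limit of Riemann sums over tagged divisions whose mesh tends to \<open>0\<close>; for a real interval,
  \<^term>\<open>content K\<close> is its length. If \<open>S\<close> is a single point, all contents are \<open>0\<close>, so every
  function is integrable on \<open>S\<close> with integral \<open>0\<close>.

  The first conjunct is needed because a set that is not a finite union of compact intervals has
  no tagged divisions, which would make the second conjunct vacuously true.
\<close>

definition has_riemann_integral :: "(real \<Rightarrow> real) \<Rightarrow> real \<Rightarrow> real set \<Rightarrow> bool"
    (infixr "has'_riemann'_integral" 46) where
  "(f has_riemann_integral y) S \<longleftrightarrow>
     (\<exists>a b. a \<le> b \<and> S = {a..b}) \<and>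
     (\<forall>e>0. \<exists>d>0. \<forall>D. D tagged_division_of S \<and> (\<forall>(x, K)\<in>D. content K < d)
        \<longrightarrow> \<bar>(\<Sum>(x, K)\<in>D. content K * f x) - y\<bar> < e)"

definition riemann_integrable_on :: "(real \<Rightarrow> real) \<Rightarrow> real set \<Rightarrow> bool"
    (infixr "riemann'_integrable'_on" 46) where
  "f riemann_integrable_on S \<longleftrightarrow> (\<exists>y. (f has_riemann_integral y) S)"

text \<open>The integral from \<open>a\<close> to \<open>b\<close>, with the usual change of sign when \<open>b < a\<close>.\<close>

definition riemann_integral :: "real \<Rightarrow> real \<Rightarrow> (real \<Rightarrow> real) \<Rightarrow> real" where
  "riemann_integral a b f =
     (if a \<le> b then (THE y. (f has_riemann_integral y) {a..b})
      else - (THE y. (f has_riemann_integral y) {b..a}))"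

lemma has_riemann_integral_imp_has_integral:
  assumes "(f has_riemann_integral y) S"
  shows "(f has_integral y) S"
proof -
  obtain a b where S: "S = cbox a b"
    using assms by (auto simp: has_riemann_integral_def)
  show ?thesis
    unfolding S has_integral
  proof (intro allI impI)
    fix e :: real assume "e > 0"
    then obtain d where d: "d > 0" and *:
      "\<And>D. D tagged_division_of S \<Longrightarrow> (\<forall>(x, K)\<in>D. content K < d) \<Longrightarrow>
        \<bar>(\<Sum>(x, K)\<in>D. content K * f x) - y\<bar> < e"
      using assms unfolding has_riemann_integral_def by blast
    show "\<exists>\<gamma>. gauge \<gamma> \<and> (\<forall>D. D tagged_division_of cbox a b \<and> \<gamma> fine D \<longrightarrow>
        norm ((\<Sum>(x, K)\<in>D. content K *\<^sub>R f x) - y) < e)"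
    proof (intro exI[of _ "\<lambda>x. ball x (d / 2)"] conjI allI impI)
      show "gauge (\<lambda>x::real. ball x (d / 2))"
        using d by (simp add: gauge_ball)
      fix D assume D: "D tagged_division_of cbox a b \<and> (\<lambda>x. ball x (d / 2)) fine D"
      have "content K < d" if xK: "(x, K) \<in> D" for x K
      proof -
        obtain u v where uv: "K = cbox u v"
          using D xK by (meson tagged_division_ofD(4))
        have "x \<in> K" using D xK by (meson tagged_division_ofD(2))
        moreover have "K \<subseteq> ball x (d / 2)" using D xK by (auto simp: fine_def)
        moreover have "u \<le> v" "u \<in> K" "v \<in> K"
          using uv \<open>x \<in> K\<close> by auto
        ultimately have "u \<le> v" "u \<in> ball x (d / 2)" "v \<in> ball x (d / 2)"
          by blast+
        then have "v - u < d"
          unfolding mem_ball dist_real_def by linarith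
        then show ?thesis using uv \<open>u \<le> v\<close> by simp
      qed
      then show "norm ((\<Sum>(x, K)\<in>D. content K *\<^sub>R f x) - y) < e"
        using *[of D] D S by auto
    qed
  qed
qed

lemma has_riemann_integral_unique:
  "(f has_riemann_integral y) S \<Longrightarrow> (f has_riemann_integral z) S \<Longrightarrow> y = z"
  by (meson has_integral_unique has_riemann_integral_imp_has_integral)

lemma riemann_integral_eq:
  assumes "(f has_riemann_integral y) {a..b}"
  shows "riemann_integral a b f = y"
proof -
  have "a \<le> b"
    using assms by (auto simp: has_riemann_integral_def)
  then show ?thesis
    using assms has_riemann_integral_unique
    by (auto simp: riemann_integral_def intro!: the_equality)
qed

lemma has_riemann_integral_singleton: "(f has_riemann_integral 0) {p..p}"
proof -
  have "(\<Sum>(x, K)\<in>D. content K * f x) = 0" if D: "D tagged_division_of {p..p}" for D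
  proof (rule sum.neutral, clarify)
    fix x K assume xK: "(x, K) \<in> D"
    obtain u v where uv: "K = cbox u v"
      using D xK by (meson tagged_division_ofD(4))
    have "K \<subseteq> {p..p}" using D xK by (meson tagged_division_ofD(3))
    then have "content K = 0"
      using uv by (cases "u \<le> v") (auto simp: subset_iff)
    then show "content K * f x = 0" by simp
  qed
  then show ?thesis
    unfolding has_riemann_integral_def by (metis abs_zero diff_zero order_refl)
qed

end

theory Submission
  imports Defs
begin

text \<open>
  By Lebesgue's criterion (\<open>riemann_integrable_iff\<close>), a function on a compact interval is Riemann
  integrable iff it is bounded and its set of discontinuities is null. Both functions in the
  theorem are bounded, so the equivalence is a statement about null sets. The function \<open>G\<close> is Lipschitz,
  and \<open>G' = g\<close> at every point where \<open>g\<close> is continuous, that is, almost everywhere. The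
  Lipschitz function \<open>G\<close> maps null sets to null sets, and two further facts relate null sets on both sides:

  \<^item> the set of points where \<open>G' = 0\<close> has a null image
    (Sard's lemma, \<open>negligible_image_of_zero_derivative\<close>);
  \<^item> the points where \<open>G'\<close> exists, is nonzero, and \<open>G\<close> takes values in a given null set form a null
    set (\<open>negligible_nonzero_derivative_preimage\<close>).

  If \<open>f\<close> is integrable, then \<open>(f \<circ> G) g\<close> can be discontinuous at a point of continuity of \<open>g\<close> only if \<open>g\<close>
  is nonzero there and \<open>G\<close> takes a value at which \<open>f\<close> is discontinuous. By the second fact such
  points form a null set.

  If \<open>(f \<circ> G) g\<close> is integrable, let \<open>f\<close> be discontinuous at \<open>G t\<close>. Then \<open>t\<close> is an end point of
  the interval, or one of \<open>g\<close> and \<open>(f \<circ> G) g\<close> is discontinuous at \<open>t\<close>, or \<open>g t = 0\<close>: otherwise \<open>f \<circ> G\<close>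
  is continuous at \<open>t\<close> and \<open>G\<close> is open at \<open>t\<close>. The images of the first three kinds of points are null since \<open>G\<close> is Lipschitz, and
  the image of the last kind is null by Sard's lemma.

  Finally, let \<open>F\<close> be an indefinite integral of \<open>f\<close>. Off a null set, \<open>F \<circ> G\<close> has derivative \<open>(f \<circ> G) g\<close>,
  and a Lipschitz function whose derivative vanishes almost everywhere is constant
  (\<open>Lipschitz_zero_derivative_ae_imp_constant\<close>), again by Sard's lemma. This gives the equality of the
  integrals.
\<close>

section \<open>Null sets and derivatives\<close>

text \<open>
  The one-dimensional case of Sard's lemma. The lemma \<open>baby_Sard\<close> is about maps between the
  types \<open>real^'m\<close> and \<open>real^'n\<close>, so the function is conjugated with the isometry
  between \<open>real\<close> and \<open>real^1\<close>.
\<close>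
lemma negligible_image_of_zero_derivative:
  fixes h :: "real \<Rightarrow> real"
  assumes h: "\<And>x. x \<in> S \<Longrightarrow> (h has_real_derivative 0) (at x within S)"
  shows "negligible (h ` S)"
proof -
  let ?lift = "vec :: real \<Rightarrow> real^1" and ?drop = "\<lambda>x::real^1. x $ 1"
  have der: "(?lift \<circ> h \<circ> ?drop has_derivative (\<lambda>_. 0)) (at x within ?lift ` S)"
    if x: "x \<in> ?lift ` S" for x
  proof -
    obtain z where z: "x = ?lift z" "z \<in> S" using x by blast
    have "(h has_derivative (\<lambda>x. x * (\<lambda>_. 0) z)) (at z within S)"
      using h[OF z(2)] by (simp add: has_field_derivative_def lambda_zero)
    from has_derivative_vector_1[OF this] z show ?thesis
      by (simp add: o_def has_derivative_def)
  qed
  have "negligible ((?lift \<circ> h \<circ> ?drop) ` (?lift ` S))"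
  proof (rule baby_Sard[OF _ der])
    show "CARD(1) \<le> CARD(1)" by simp
    have "matrix (\<lambda>_. 0 :: real^1) = (0 :: real^1^1)"
      by (simp add: matrix_def vec_eq_iff)
    then show "rank (matrix (\<lambda>_. 0 :: real^1) :: real^1^1) < CARD(1)"
      by simp
  qed
  moreover have "(\<lambda>x. x $ 1) differentiable_on (T :: (real^1) set)" for T
    by (simp add: bounded_linear_imp_differentiable_on bounded_linear_vec_nth)
  ultimately have "negligible (?drop ` ((?lift \<circ> h \<circ> ?drop) ` (?lift ` S)))"
    by (rule negligible_differentiable_image_negligible[rotated]) simp_all
  then show ?thesis
    by (simp add: image_comp o_def)
qed

lemma negligible_Lipschitz_image:
  fixes h :: "real \<Rightarrow> real"
  assumes "negligible S" and "\<And>x y. x \<in> S \<Longrightarrow> y \<in> S \<Longrightarrow> \<bar>h x - h y\<bar> \<le> B * \<bar>x - y\<bar>"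
  shows "negligible (h ` S)"
proof (rule negligible_locally_Lipschitz_image[OF _ assms(1)])
  show "\<exists>T B. open T \<and> x \<in> T \<and> (\<forall>y \<in> S \<inter> T. norm (h y - h x) \<le> B * norm (y - x))"
    if "x \<in> S" for x
    using that assms(2) by (intro exI[of _ UNIV] exI[of _ B]) auto
qed simp

text \<open>
  A converse to the preceding lemma: if \<open>h\<close> does not contract small distances by more
  than a fixed factor, then on sets of small diameter it has a Lipschitz inverse, which
  carries the null set back. Negligibility is a local property, so small pieces suffice.
\<close>
lemma negligible_if_expanding:
  fixes h :: "real \<Rightarrow> real"
  assumes neg: "negligible (h ` S)" and "r > 0"
    and exp: "\<And>x y. x \<in> S \<Longrightarrow> y \<in> S \<Longrightarrow> \<bar>x - y\<bar> < r \<Longrightarrow> \<bar>x - y\<bar> \<le> B * \<bar>h x - h y\<bar>"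
  shows "negligible S"
proof (subst locally_negligible_alt, intro ballI exI conjI)
  fix x assume x: "x \<in> S"
  let ?U = "S \<inter> ball x (r / 2)"
  show "openin (top_of_set S) ?U" "x \<in> ?U"
    using x \<open>r > 0\<close> by auto
  have *: "\<bar>u - v\<bar> \<le> B * \<bar>h u - h v\<bar>" if "u \<in> ?U" "v \<in> ?U" for u v
  proof (rule exp)
    show "u \<in> S" "v \<in> S" using that by auto
    have "dist x u < r / 2" "dist x v < r / 2" using that by auto
    then show "\<bar>u - v\<bar> < r" unfolding dist_real_def by linarith
  qed
  then have inj: "inj_on h ?U"
    unfolding inj_on_def by force
  have "negligible (inv_into ?U h ` (h ` ?U))"
  proof (rule negligible_Lipschitz_image)
    show "negligible (h ` ?U)"
      using neg by (rule negligible_subset) auto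
    show "\<bar>inv_into ?U h y - inv_into ?U h z\<bar> \<le> B * \<bar>y - z\<bar>"
      if "y \<in> h ` ?U" "z \<in> h ` ?U" for y z
      using that *[OF inv_into_into[OF that(1)] inv_into_into[OF that(2)]]
      by (simp add: f_inv_into_f)
  qed
  then show "negligible ?U"
    using inj by simp
qed

text \<open>
  A nonzero derivative at \<open>x\<close> gives an expansion bound around \<open>x\<close>, with a constant and a radius that
  depend on \<open>x\<close>. Sorting the points by these data splits \<open>S\<close> into countably many sets on which
  the expansion is uniform.
\<close>
lemma negligible_if_image_negligible:
  fixes h :: "real \<Rightarrow> real"
  assumes der: "\<And>x. x \<in> S \<Longrightarrow> (h has_real_derivative d x) (at x within S)"
    and nz: "\<And>x. x \<in> S \<Longrightarrow> d x \<noteq> 0" and neg: "negligible (h ` S)"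
  shows "negligible S"
proof -
  define T where "T n = {x \<in> S. \<forall>y\<in>S. \<bar>x - y\<bar> < 1 / real (Suc n) \<longrightarrow>
      \<bar>x - y\<bar> \<le> real (Suc n) * \<bar>h x - h y\<bar>}" for n
  have "negligible (T n)" for n
  proof (rule negligible_if_expanding)
    show "negligible (h ` T n)"
      using neg by (rule negligible_subset) (auto simp: T_def)
    show "0 < 1 / real (Suc n)" by simp
    show "\<bar>x - y\<bar> \<le> real (Suc n) * \<bar>h x - h y\<bar>"
      if "x \<in> T n" "y \<in> T n" "\<bar>x - y\<bar> < 1 / real (Suc n)" for x y
      using that by (simp add: T_def)
  qed
  moreover have "S \<subseteq> (\<Union>n. T n)"
  proof
    fix x assume x: "x \<in> S"
    have "((\<lambda>y. (h y - h x) / (y - x)) \<longlongrightarrow> d x) (at x within S)"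
      using der[OF x] by (simp add: has_field_derivative_iff)
    then have "\<forall>\<^sub>F y in at x within S. dist ((h y - h x) / (y - x)) (d x) < \<bar>d x\<bar> / 2"
      using nz[OF x] by (intro tendstoD) auto
    then obtain r where r: "r > 0" and
      *: "\<And>y. y \<in> S \<Longrightarrow> y \<noteq> x \<Longrightarrow> dist y x < r \<Longrightarrow>
            \<bar>(h y - h x) / (y - x) - d x\<bar> < \<bar>d x\<bar> / 2"
      unfolding eventually_at dist_real_def by blast
    obtain n where n: "max (1 / r) (2 / \<bar>d x\<bar>) < real (Suc n)"
      by (meson reals_Archimedean2 less_trans lessI of_nat_less_iff)
    have "\<bar>x - y\<bar> \<le> real (Suc n) * \<bar>h x - h y\<bar>"
      if y: "y \<in> S" "\<bar>x - y\<bar> < 1 / real (Suc n)" for y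
    proof (cases "y = x")
      case False
      have "1 / r < real (Suc n)" using n by simp
      then have "1 / real (Suc n) < r"
        using r by (simp add: field_simps)
      then have "\<bar>(h y - h x) / (y - x) - d x\<bar> < \<bar>d x\<bar> / 2"
        using y False by (intro *) (auto simp: dist_real_def)
      then have "\<bar>d x\<bar> / 2 \<le> \<bar>(h y - h x) / (y - x)\<bar>" by linarith
      then have "\<bar>d x\<bar> / 2 * \<bar>x - y\<bar> \<le> \<bar>h x - h y\<bar>"
        using False by (simp add: abs_divide abs_minus_commute pos_le_divide_eq)
      moreover have "1 \<le> real (Suc n) * (\<bar>d x\<bar> / 2)"
      proof -
        have "2 / \<bar>d x\<bar> < real (Suc n)" using n by simp
        then show ?thesis using nz[OF x] by (simp add: field_simps)
      qed
      ultimately have "\<bar>x - y\<bar> \<le> real (Suc n) * (\<bar>d x\<bar> / 2) * \<bar>x - y\<bar>"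
        and "real (Suc n) * (\<bar>d x\<bar> / 2 * \<bar>x - y\<bar>) \<le> real (Suc n) * \<bar>h x - h y\<bar>"
        using mult_right_mono[of 1 "real (Suc n) * (\<bar>d x\<bar> / 2)" "\<bar>x - y\<bar>"]
        by (simp, intro mult_left_mono) simp_all
      then show ?thesis by (metis mult.assoc order_trans)
    qed simp
    then show "x \<in> (\<Union>n. T n)"
      using x by (auto simp: T_def)
  qed
  ultimately show ?thesis
    by (meson negligible_countable_Union negligible_subset negligible_Union_nat)
qed

text \<open>
  The image of the interval is connected; it is also null, since the exceptional set has a null
  image by the Lipschitz condition and the rest has a null image by Sard's lemma. Hence it is a point.
\<close>
lemma Lipschitz_zero_derivative_ae_imp_constant:
  fixes h :: "real \<Rightarrow> real"
  assumes "a \<le> b"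
    and lip: "\<And>x y. x \<in> {a..b} \<Longrightarrow> y \<in> {a..b} \<Longrightarrow> \<bar>h x - h y\<bar> \<le> B * \<bar>x - y\<bar>"
    and N: "negligible N"
    and der: "\<And>x. x \<in> {a..b} - N \<Longrightarrow> (h has_real_derivative 0) (at x within {a..b})"
  shows "h a = h b"
proof (rule ccontr)
  assume ne: "h a \<noteq> h b"
  have "negligible (h ` ({a..b} \<inter> N))"
    by (rule negligible_Lipschitz_image[OF _ lip]) (auto intro: negligible_subset[OF N])
  moreover have "negligible (h ` ({a..b} - N))"
    by (rule negligible_image_of_zero_derivative)
       (blast intro: DERIV_subset[OF der])
  moreover have "h ` {a..b} = h ` ({a..b} \<inter> N) \<union> h ` ({a..b} - N)" by blast
  ultimately have neg: "negligible (h ` {a..b})"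
    by simp
  have "B-lipschitz_on {a..b} h" if "B \<ge> 0"
    using that lip by (auto simp: lipschitz_on_def dist_real_def)
  moreover have "B \<ge> 0"
  proof -
    have "0 \<le> B * (b - a)" using lip[of a b] \<open>a \<le> b\<close> by simp
    moreover have "a < b" using \<open>a \<le> b\<close> ne by (cases "a = b") auto
    ultimately show ?thesis by (simp add: zero_le_mult_iff)
  qed
  ultimately have "connected (h ` {a..b})"
    by (intro connected_continuous_image lipschitz_on_continuous_on) auto
  then have "{min (h a) (h b)..max (h a) (h b)} \<subseteq> h ` {a..b}"
    using \<open>a \<le> b\<close> by (intro connected_contains_Icc) (auto simp: min_def max_def)
  then have "negligible (cbox (min (h a) (h b)) (max (h a) (h b)))"
    using negligible_subset[OF neg] by simp
  then have "box (min (h a) (h b)) (max (h a) (h b)) = {}"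
    using negligible_interval by blast
  then show False using ne by (auto simp: box_real min_def max_def split: if_splits)
qed

section \<open>Lebesgue's criterion\<close>

text \<open>
  Continuity is taken relative to \<open>S\<close>, since the integral over \<open>S\<close> does not depend on values outside \<open>S\<close>.
\<close>
definition discontinuities :: "(real \<Rightarrow> real) \<Rightarrow> real set \<Rightarrow> real set" where
  "discontinuities f S = {x \<in> S. \<not> continuous (at x within S) f}"

lemma fine_division_real:
  fixes a b :: real
  assumes "d > 0"
  obtains \<D> where "\<D> division_of {a..b}" "\<And>K. K \<in> \<D> \<Longrightarrow> content K < d"
proof -
  have "gauge (\<lambda>x::real. ball x (d / 2))" using assms by (simp add: gauge_ball)
  then obtain p where p: "p tagged_division_of {a..b}" "(\<lambda>x. ball x (d / 2)) fine p"
    using fine_division_exists_real by blast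
  show thesis
  proof
    show "snd ` p division_of {a..b}"
      using p(1) by (rule division_of_tagged_division)
    fix K assume "K \<in> snd ` p"
    then obtain x where x: "(x, K) \<in> p" by auto
    then obtain u v where uv: "K = {u..v}"
      using p(1) by (metis tagged_division_ofD(4) box_real(2))
    have "x \<in> K" "K \<subseteq> ball x (d / 2)"
      using x p by (auto simp: fine_def dest: tagged_division_ofD(2))
    moreover from this have "u \<in> ball x (d / 2)" "v \<in> ball x (d / 2)" "u \<le> v"
      unfolding uv by (auto simp: subset_iff)
    ultimately show "content K < d"
      unfolding uv by (simp add: dist_real_def)
  qed
qed

lemma tagged_division_of_division:
  assumes "\<D> division_of S" "\<And>K. K \<in> \<D> \<Longrightarrow> \<xi> K \<in> K"
  shows "(\<lambda>K. (\<xi> K, K)) ` \<D> tagged_division_of S"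
  using assms unfolding tagged_division_of division_of_def by fast

text \<open>
  Both halves of the necessity of Lebesgue's criterion rest on this: for one fine division, the tags
  can be moved arbitrarily and independently of each other while the Riemann sum hardly changes.
\<close>
lemma riemann_integrable_small_variation:
  assumes "f riemann_integrable_on {a..b}" "e > 0"
  obtains \<D> where "\<D> division_of {a..b}"
    "\<And>\<xi> \<zeta>. (\<And>K. K \<in> \<D> \<Longrightarrow> \<xi> K \<in> K) \<Longrightarrow> (\<And>K. K \<in> \<D> \<Longrightarrow> \<zeta> K \<in> K) \<Longrightarrow>
       (\<Sum>K\<in>\<D>. content K * (f (\<xi> K) - f (\<zeta> K))) < e"
proof -
  obtain y where "(f has_riemann_integral y) {a..b}"
    using assms(1) by (auto simp: riemann_integrable_on_def)
  then obtain d where d: "d > 0" and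
    *: "\<And>D. D tagged_division_of {a..b} \<Longrightarrow> (\<forall>(x, K)\<in>D. content K < d) \<Longrightarrow>
          \<bar>(\<Sum>(x, K)\<in>D. content K * f x) - y\<bar> < e / 2"
    using assms(2) unfolding has_riemann_integral_def by (metis half_gt_zero)
  obtain \<D> where \<D>: "\<D> division_of {a..b}" "\<And>K. K \<in> \<D> \<Longrightarrow> content K < d"
    using fine_division_real[OF d] by blast
  have sum: "\<bar>(\<Sum>K\<in>\<D>. content K * f (\<xi> K)) - y\<bar> < e / 2"
    if "\<And>K. K \<in> \<D> \<Longrightarrow> \<xi> K \<in> K" for \<xi>
  proof -
    have "(\<Sum>(x, K)\<in>(\<lambda>K. (\<xi> K, K)) ` \<D>. content K * f x) = (\<Sum>K\<in>\<D>. content K * f (\<xi> K))"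
      by (subst sum.reindex) (auto simp: inj_on_def)
    moreover have "\<forall>(x, K)\<in>(\<lambda>K. (\<xi> K, K)) ` \<D>. content K < d"
      using \<D>(2) by auto
    ultimately show ?thesis
      using *[OF tagged_division_of_division[OF \<D>(1) that]] by simp
  qed
  show thesis
  proof
    fix \<xi> \<zeta> assume tags: "\<And>K. K \<in> \<D> \<Longrightarrow> \<xi> K \<in> K" "\<And>K. K \<in> \<D> \<Longrightarrow> \<zeta> K \<in> K"
    have "(\<Sum>K\<in>\<D>. content K * f (\<xi> K)) - (\<Sum>K\<in>\<D>. content K * f (\<zeta> K)) < e"
      using sum[of \<xi>, OF tags(1)] sum[of \<zeta>, OF tags(2)] by linarith
    then show "(\<Sum>K\<in>\<D>. content K * (f (\<xi> K) - f (\<zeta> K))) < e"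
      by (simp add: right_diff_distrib sum_subtractf)
  qed (rule \<D>(1))
qed

text \<open>
  Moving the tag of a single cell \<open>K\<close> of positive length changes the Riemann sum
  by \<open>content K\<close> times the change of \<open>f\<close>, so \<open>f\<close> is bounded on \<open>K\<close>. The cells of length \<open>0\<close> are points.
\<close>
lemma riemann_integrable_imp_bounded:
  assumes "f riemann_integrable_on {a..b}"
  shows "bounded (f ` {a..b})"
proof -
  obtain \<D> where \<D>: "\<D> division_of {a..b}" and
    *: "\<And>\<xi> \<zeta>. (\<And>K. K \<in> \<D> \<Longrightarrow> \<xi> K \<in> K) \<Longrightarrow> (\<And>K. K \<in> \<D> \<Longrightarrow> \<zeta> K \<in> K) \<Longrightarrow>
       (\<Sum>K\<in>\<D>. content K * (f (\<xi> K) - f (\<zeta> K))) < 1"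
    using riemann_integrable_small_variation[OF assms zero_less_one] by blast
  obtain \<tau> where \<tau>: "\<tau> K \<in> K" if "K \<in> \<D>" for K
    using division_ofD(3)[OF \<D>] by (metis ex_in_conv)
  have "bounded (f ` K)" if K: "K \<in> \<D>" for K
  proof (cases "content K = 0")
    case True
    obtain u v where "K = {u..v}" "u \<le> v"
      using division_ofD(3)[OF \<D> K] division_ofD(4)[OF \<D> K] by (metis atLeastatMost_empty_iff box_real(2))
    then show ?thesis using True by simp
  next
    case False
    then have pos: "content K > 0" by (simp add: order_less_le)
    have *: "content K * (f x - f y) < 1" if "x \<in> K" "y \<in> K" for x y
    proof -
      have "(\<Sum>L\<in>\<D>. content L * (f ((\<tau>(K := x)) L) - f ((\<tau>(K := y)) L)))
          = (\<Sum>L\<in>\<D>. if L = K then content K * (f x - f y) else 0)"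
        by (rule sum.cong) auto
      also have "\<dots> = content K * (f x - f y)"
        using K division_ofD(1)[OF \<D>] by simp
      finally show ?thesis
        using *[of "\<tau>(K := x)" "\<tau>(K := y)"] \<tau> that by (auto split: if_splits)
    qed
    have "\<bar>f x\<bar> \<le> \<bar>f (\<tau> K)\<bar> + 1 / content K" if "x \<in> K" for x
    proof -
      have "f x - f (\<tau> K) < 1 / content K" "f (\<tau> K) - f x < 1 / content K"
        using *[OF that \<tau>[OF K]] *[OF \<tau>[OF K] that] pos
        by (simp_all add: pos_less_divide_eq mult.commute)
      then show ?thesis by linarith
    qed
    then show ?thesis
      unfolding bounded_iff by (metis imageE real_norm_def)
  qed
  moreover have "f ` {a..b} = (\<Union>K\<in>\<D>. f ` K)"
    using division_ofD(6)[OF \<D>] by auto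
  ultimately show ?thesis
    using division_ofD(1)[OF \<D>] by (simp add: bounded_Union)
qed

text \<open>
  The set \<open>J r\<close> of points at which \<open>f\<close> has a jump of at least \<open>r\<close> is covered, apart from end
  points of cells, by the cells on which \<open>f\<close> oscillates by at least \<open>r\<close>. Choosing the tags of these cells so as to
  realise the oscillation shows that \<open>r\<close> times their total length is small.
\<close>
lemma riemann_integrable_imp_negligible_discontinuities:
  assumes f: "f riemann_integrable_on {a..b}"
  shows "negligible (discontinuities f {a..b})"
proof -
  define J where "J r = {x \<in> {a..b}. \<forall>d>0. \<exists>y\<in>{a..b}. dist y x < d \<and> r \<le> \<bar>f y - f x\<bar>}" for r :: real
  have neg: "negligible (J r)" if r: "r > 0" for r
    unfolding negligible_outer_le
  proof (intro allI impI)
    fix e :: real assume "e > 0"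
    then have "e * r > 0" using r by simp
    then obtain \<D> where \<D>: "\<D> division_of {a..b}" and
      *: "\<And>\<xi> \<zeta>. (\<And>K. K \<in> \<D> \<Longrightarrow> \<xi> K \<in> K) \<Longrightarrow> (\<And>K. K \<in> \<D> \<Longrightarrow> \<zeta> K \<in> K) \<Longrightarrow>
         (\<Sum>K\<in>\<D>. content K * (f (\<xi> K) - f (\<zeta> K))) < e * r"
      using riemann_integrable_small_variation[OF f] by blast
    note fin = division_ofD(1)[OF \<D>]
    define bad where "bad = {K \<in> \<D>. \<exists>x\<in>K. \<exists>y\<in>K. r \<le> f x - f y}"
    have "\<exists>\<xi> \<zeta>. \<xi> \<in> K \<and> \<zeta> \<in> K \<and> (if K \<in> bad then r else 0) \<le> f \<xi> - f \<zeta>" if K: "K \<in> \<D>" for K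
    proof (cases "K \<in> bad")
      case False
      obtain x where "x \<in> K" using division_ofD(3)[OF \<D> K] by blast
      then show ?thesis using False by auto
    qed (auto simp: bad_def)
    then obtain \<xi> \<zeta> where \<xi>: "\<And>K. K \<in> \<D> \<Longrightarrow> \<xi> K \<in> K" "\<And>K. K \<in> \<D> \<Longrightarrow> \<zeta> K \<in> K"
      and osc: "\<And>K. K \<in> \<D> \<Longrightarrow> (if K \<in> bad then r else 0) \<le> f (\<xi> K) - f (\<zeta> K)"
      by metis
    have finb: "finite bad" "bad \<subseteq> \<D>" using fin by (auto simp: bad_def)
    have meas: "K \<in> lmeasurable" if "K \<in> \<D>" for K
      using division_ofD(4)[OF \<D> that] by auto
    have "(\<Sum>K\<in>bad. content K) * r = (\<Sum>K\<in>\<D>. content K * (if K \<in> bad then r else 0))"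
      using finb fin by (simp add: sum_distrib_right if_distrib sum.If_cases Int_absorb1 cong: if_cong)
    also have "\<dots> \<le> (\<Sum>K\<in>\<D>. content K * (f (\<xi> K) - f (\<zeta> K)))"
      by (intro sum_mono mult_left_mono osc) auto
    also have "\<dots> < e * r" using \<xi> by (rule *)
    finally have small: "(\<Sum>K\<in>bad. content K) < e" using r by simp
    define P where "P = (\<Union>K\<in>\<D>. frontier K)"
    have P: "negligible P"
      unfolding P_def
    proof (intro negligible_Union finite_imageI fin, elim imageE)
      fix S K assume "S = frontier K" "K \<in> \<D>"
      then show "negligible S"
        using division_ofD(4)[OF \<D>] negligible_convex_frontier convex_box by metis
    qed
    have "measure lebesgue (\<Union>bad) \<le> (\<Sum>K\<in>bad. measure lebesgue K)"
      using measure_UNION_le[of bad "\<lambda>K. K" lebesgue] finb meas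
      by (auto simp: fmeasurableD subset_iff)
    also have "\<dots> = (\<Sum>K\<in>bad. content K)"
    proof (rule sum.cong)
      fix K assume "K \<in> bad"
      then obtain u v where "K = cbox u v" using division_ofD(4)[OF \<D>] finb by blast
      then show "measure lebesgue K = content K" by (simp add: measure_completion)
    qed simp
    finally have "measure lebesgue (\<Union>bad) < e" using small by simp
    moreover have mb: "\<Union>bad \<in> lmeasurable"
      using finb meas by (intro fmeasurable.finite_Union) auto
    moreover have "J r \<subseteq> \<Union>bad \<union> P"
    proof
      fix x assume x: "x \<in> J r"
      show "x \<in> \<Union>bad \<union> P"
      proof (cases "x \<in> P")
        case False
        obtain K where K: "K \<in> \<D>" "x \<in> K"
          using x UnionE[of x \<D>] unfolding division_ofD(6)[OF \<D>] J_def by blast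
        then have "x \<in> interior K"
          using False by (auto simp: P_def frontier_def dest: closure_subset[THEN subsetD])
        then obtain d where d: "d > 0" "ball x d \<subseteq> K"
          by (auto simp: mem_interior)
        then obtain y where y: "dist y x < d" "r \<le> \<bar>f y - f x\<bar>"
          using x by (auto simp: J_def)
        then have "y \<in> K" using d by (auto simp: dist_commute)
        moreover have "r \<le> f x - f y \<or> r \<le> f y - f x" using y by linarith
        ultimately have "K \<in> bad" using K by (auto simp: bad_def)
        then show ?thesis using K by blast
      qed simp
    qed
    ultimately show "\<exists>T. J r \<subseteq> T \<and> T \<in> lmeasurable \<and> measure lebesgue T \<le> e"
      using P by (intro exI[of _ "\<Union>bad \<union> P"])
        (simp add: negligible_imp_measurable fmeasurable.Un negligible_iff_null_sets
          measure_Un_null_set fmeasurableD)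
  qed
  have "discontinuities f {a..b} \<subseteq> (\<Union>n. J (1 / real (Suc n)))"
  proof
    fix x assume x: "x \<in> discontinuities f {a..b}"
    then obtain r where r: "r > 0" "\<forall>d>0. \<exists>y\<in>{a..b}. dist y x < d \<and> \<not> dist (f y) (f x) < r"
      by (auto simp: discontinuities_def continuous_within_eps_delta)
    obtain n where "1 / real (Suc n) < r"
      using r(1) nat_approx_posE by blast
    with r x have "x \<in> J (1 / real (Suc n))"
      by (fastforce simp: J_def discontinuities_def dist_real_def)
    then show "x \<in> (\<Union>n. J (1 / real (Suc n)))" by blast
  qed
  moreover have "negligible (\<Union>n. J (1 / real (Suc n)))"
    by (intro negligible_Union_nat neg) simp
  ultimately show ?thesis by (rule negligible_subset[rotated])
qed

text \<open>
  A Riemann sum is the gauge integral of a step function. This turns the convergence of Riemann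
  sums into a question about limits under the integral sign.
\<close>
lemma tagged_division_step_function_has_integral:
  assumes D: "D tagged_division_of {a..b}"
  shows "((\<lambda>y. \<Sum>(x, K)\<in>D. f x * indicator K y) has_integral (\<Sum>(x, K)\<in>D. content K * f x)) {a..b}"
proof -
  have "((\<lambda>y. f x * indicator K y) has_integral content K * f x) {a..b}" if "(x, K) \<in> D" for x K
  proof -
    obtain u v where uv: "K = cbox u v" using D \<open>(x, K) \<in> D\<close> by (meson tagged_division_ofD(4))
    have "((\<lambda>y. if y \<in> K then f x else 0) has_integral content K * f x) {a..b}"
      using has_integral_const[of "f x" u v] tagged_division_ofD(3)[OF D that]
      by (subst has_integral_restrict) (auto simp: uv)
    moreover have "(\<lambda>y. if y \<in> K then f x else 0) = (\<lambda>y. f x * indicator K y)"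
      by (auto simp: indicator_def)
    ultimately show ?thesis by simp
  qed
  then show ?thesis
    using tagged_division_ofD(1)[OF D]
    by (intro has_integral_sum) (auto simp del: indicator_simps)
qed

lemma tagged_division_step_function_eq:
  assumes D: "D tagged_division_of {a..b}" and y: "y \<in> {a..b}" "\<And>x K. (x, K) \<in> D \<Longrightarrow> y \<notin> frontier K"
  obtains x K where "(x, K) \<in> D" "y \<in> K" "(\<Sum>(x, K)\<in>D. f x * indicator K y) = (f x :: real)"
proof -
  obtain x K where xK: "(x, K) \<in> D" "y \<in> K"
    using y(1) tagged_division_ofD(6)[OF D] by blast
  have int: "y \<in> interior L" if "(z, L) \<in> D" "y \<in> L" for z L
    using y(2)[OF that(1)] that(2) closure_subset by (auto simp: frontier_def)
  have "y \<notin> L" if "(z, L) \<in> D - {(x, K)}" for z L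
    using tagged_division_ofD(5)[OF D, of z L x K] xK int[of x K] int[of z L] that by auto
  then have "f (fst p) * indicator (snd p) y = 0" if "p \<in> D - {(x, K)}" for p
    using that by (cases p) simp
  then have "(\<Sum>(x, K)\<in>D - {(x, K)}. f x * indicator K y) = 0"
    unfolding case_prod_beta by (rule sum.neutral[rule_format])
  then have "(\<Sum>(x, K)\<in>D. f x * indicator K y) = f x * indicator K y"
    by (subst sum.remove[OF tagged_division_ofD(1)[OF D] xK(1)]) simp
  also have "\<dots> = f x" using xK(2) by simp
  finally show thesis by (rule that[OF xK])
qed

text \<open>
  At a point of continuity that is not an end point of a cell, the step functions of the Riemann
  sums converge to \<open>f\<close>, because the tags of the cells containing the point converge to it. Both
  kinds of excluded points form a null set, and dominated convergence applies.
\<close>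
lemma riemann_sums_tendsto_integral:
  assumes bdd: "bounded (f ` {a..b})" and neg: "negligible (discontinuities f {a..b})"
    and D: "\<And>n. D n tagged_division_of {a..b}"
    and mesh: "\<And>n x K. (x, K) \<in> D n \<Longrightarrow> content K < 1 / real (Suc n)"
  shows "(\<lambda>n. \<Sum>(x, K)\<in>D n. content K * f x) \<longlonglongrightarrow> integral {a..b} f"
proof -
  obtain M where M: "\<And>x. x \<in> {a..b} \<Longrightarrow> \<bar>f x\<bar> \<le> M"
    using bdd unfolding bounded_iff by (metis imageI real_norm_def)
  define N where "N = discontinuities f {a..b} \<union> (\<Union>n. \<Union>(x, K)\<in>D n. frontier K)"
  \<comment> \<open>Setting the step functions to \<open>0\<close> on the null set \<open>N\<close> keeps their integrals and makes
    the bound and the convergence hold at every point.\<close>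
  define s where "s n y = (\<Sum>(x, K)\<in>D n. f x * indicator K y)" for n y
  define u where "u n y = (if y \<in> N then 0 else s n y)" for n y
  have N: "negligible N"
    unfolding N_def
  proof (intro negligible_Un neg negligible_Union_nat negligible_Union)
    fix n show "finite ((\<lambda>(x, K). frontier K) ` D n)"
      using tagged_division_ofD(1)[OF D] by blast
    show "negligible S" if S: "S \<in> (\<lambda>(x, K). frontier K) ` D n" for S
    proof -
      obtain x K where "(x, K) \<in> D n" "S = frontier K" using S by auto
      then show ?thesis
        using tagged_division_ofD(4)[OF D] negligible_convex_frontier convex_box by metis
    qed
  qed
  have u: "(u n has_integral (\<Sum>(x, K)\<in>D n. content K * f x)) {a..b}" for n
    by (rule has_integral_spike[OF N _ tagged_division_step_function_has_integral[OF D]])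
       (auto simp: u_def s_def)
  have eq: "\<exists>x\<in>{a..b}. \<bar>x - y\<bar> < 1 / real (Suc n) \<and> u n y = f x"
    if y: "y \<in> {a..b}" "y \<notin> N" for y n
  proof -
    obtain x K where xK: "(x, K) \<in> D n" "y \<in> K" "s n y = f x"
      unfolding s_def
      by (rule tagged_division_step_function_eq[OF D[of n] y(1), of f])
         (use y(2) in \<open>auto simp: N_def\<close>)
    obtain v w where vw: "K = {v..w}"
      using D xK(1) by (metis tagged_division_ofD(4) box_real(2))
    have "x \<in> K" "K \<subseteq> {a..b}"
      using tagged_division_ofD(2,3)[OF D xK(1)] by auto
    then show ?thesis
      using xK mesh[OF xK(1)] y(2) by (intro bexI[of _ x]) (auto simp: vw u_def)
  qed
  let ?g = "\<lambda>y. if y \<in> N then 0 else f y"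
  have conv: "(\<lambda>n. u n y) \<longlonglongrightarrow> ?g y" if y: "y \<in> {a..b}" for y
  proof (cases "y \<in> N")
    case False
    then obtain x where x: "\<And>n. x n \<in> {a..b}" "\<And>n. \<bar>x n - y\<bar> < 1 / real (Suc n)" "\<And>n. u n y = f (x n)"
      using eq[OF y] by metis
    have "(\<lambda>n. x n - y) \<longlonglongrightarrow> 0"
    proof (rule Lim_null_comparison)
      show "\<forall>\<^sub>F n in sequentially. norm (x n - y) \<le> 1 / real (Suc n)"
        using x(2) by (simp add: less_imp_le)
    qed (rule LIMSEQ_Suc[OF lim_1_over_n])
    then have "x \<longlonglongrightarrow> y" by (simp add: LIM_zero_iff)
    moreover have "continuous (at y within {a..b}) f"
      using y False by (auto simp: N_def discontinuities_def)
    ultimately have "(\<lambda>n. f (x n)) \<longlonglongrightarrow> f y"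
      using x(1) by (auto simp: continuous_within_sequentially o_def)
    then show ?thesis using False x(3) by simp
  qed (simp add: u_def)
  have bound: "norm (u n y) \<le> \<bar>M\<bar>" if "y \<in> {a..b}" for n y
  proof (cases "y \<in> N")
    case False
    then show ?thesis using eq[OF that] M by (metis abs_ge_self order_trans real_norm_def)
  qed (simp add: u_def)
  have "(\<lambda>n. integral {a..b} (u n)) \<longlonglongrightarrow> integral {a..b} ?g"
    using u bound conv
    by (intro dominated_convergence(2)[where h = "\<lambda>_. \<bar>M\<bar>"]) auto
  moreover have "integral {a..b} ?g = integral {a..b} f"
    by (rule integral_spike[OF N]) auto
  ultimately show ?thesis
    using integral_unique[OF u] by simp
qed

text \<open>Lebesgue's criterion for Riemann integrability.\<close>
theorem riemann_integrable_iff: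
  assumes "a \<le> b"
  shows "f riemann_integrable_on {a..b} \<longleftrightarrow>
    bounded (f ` {a..b}) \<and> negligible (discontinuities f {a..b})"
proof safe
  assume bdd: "bounded (f ` {a..b})" and neg: "negligible (discontinuities f {a..b})"
  have "(f has_riemann_integral integral {a..b} f) {a..b}"
  proof (rule ccontr)
    assume "\<not> ?thesis"
    then obtain e where e: "e > 0" and
      *: "\<And>d. d > 0 \<Longrightarrow> \<exists>D. (D tagged_division_of {a..b} \<and> (\<forall>(x, K)\<in>D. content K < d)) \<and>
         \<not> \<bar>(\<Sum>(x, K)\<in>D. content K * f x) - integral {a..b} f\<bar> < e"
      using assms unfolding has_riemann_integral_def not_all not_ex de_Morgan_conj not_imp
      by blast
    have "\<exists>D. D tagged_division_of {a..b} \<and> (\<forall>(x, K)\<in>D. content K < 1 / real (Suc n)) \<and>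
         e \<le> \<bar>(\<Sum>(x, K)\<in>D. content K * f x) - integral {a..b} f\<bar>" for n
      using *[of "1 / real (Suc n)"] by (simp add: not_less conj_assoc)
    then obtain D where D: "\<And>n. D n tagged_division_of {a..b}"
      "\<And>n. \<forall>(x, K)\<in>D n. content K < 1 / real (Suc n)" and
      far: "\<And>n. e \<le> \<bar>(\<Sum>(x, K)\<in>D n. content K * f x) - integral {a..b} f\<bar>"
      by metis
    have "(\<lambda>n. \<Sum>(x, K)\<in>D n. content K * f x) \<longlonglongrightarrow> integral {a..b} f"
      using D by (intro riemann_sums_tendsto_integral bdd neg) blast+
    then show False
      using far e by (metis (no_types, lifting) LIMSEQ_D not_le order_refl real_norm_def)
  qed
  then show "f riemann_integrable_on {a..b}"
    by (auto simp: riemann_integrable_on_def)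
qed (auto intro: riemann_integrable_imp_bounded riemann_integrable_imp_negligible_discontinuities)

section \<open>Indefinite integrals\<close>

lemma discontinuities_mono: "S \<subseteq> T \<Longrightarrow> discontinuities f S \<subseteq> discontinuities f T"
  unfolding discontinuities_def using continuous_within_subset by blast

lemma riemann_integrable_on_subinterval:
  assumes "f riemann_integrable_on {u..v}" "p \<in> {u..v}" "q \<in> {u..v}" "p \<le> q"
  shows "f riemann_integrable_on {p..q}"
proof -
  have sub: "{p..q} \<subseteq> {u..v}" using assms by auto
  have "bounded (f ` {u..v})" "negligible (discontinuities f {u..v})"
    using assms(1) riemann_integrable_imp_bounded
      riemann_integrable_imp_negligible_discontinuities by auto
  then show ?thesis
    using bounded_subset[OF _ image_mono[OF sub]] negligible_subset[OF _ discontinuities_mono[OF sub]]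
    by (simp add: riemann_integrable_iff[OF \<open>p \<le> q\<close>])
qed

lemma riemann_integral_eq_integral:
  assumes "f riemann_integrable_on {p..q}"
  shows "riemann_integral p q f = integral {p..q} f" "f integrable_on {p..q}"
proof -
  obtain y where y: "(f has_riemann_integral y) {p..q}"
    using assms by (auto simp: riemann_integrable_on_def)
  show "riemann_integral p q f = integral {p..q} f" "f integrable_on {p..q}"
    using has_riemann_integral_imp_has_integral[OF y] riemann_integral_eq[OF y]
    by (auto simp: integral_unique integrable_on_def)
qed

text \<open>
  With the sign convention for reversed limits, this holds for \<open>p\<close> and \<open>q\<close> in either order, and so
  covers \<open>G a \<le> G b\<close> and \<open>G b < G a\<close> at once.
\<close>
lemma riemann_integral_eq_diff:
  assumes f: "f riemann_integrable_on {u..v}" and p: "p \<in> {u..v}" and q: "q \<in> {u..v}"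
  shows "riemann_integral p q f = integral {u..q} f - integral {u..p} f"
proof -
  have *: "riemann_integral p q f = integral {u..q} f - integral {u..p} f"
    if "p \<le> q" "p \<in> {u..v}" "q \<in> {u..v}" for p q
  proof -
    have "integral {u..p} f + integral {p..q} f = integral {u..q} f"
      using that riemann_integral_eq_integral(2)[OF f]
      by (intro Henstock_Kurzweil_Integration.integral_combine)
         (auto intro: integrable_on_subinterval)
    then show ?thesis
      using riemann_integral_eq_integral(1)[OF riemann_integrable_on_subinterval[OF f that(2,3,1)]]
      by simp
  qed
  show ?thesis
  proof (cases "p \<le> q")
    case False
    then have "riemann_integral p q f = - riemann_integral q p f"
      by (auto simp: riemann_integral_def)
    then show ?thesis using *[of q p] p q False by simp
  qed (use * p q in blast)
qed

lemma integral_Lipschitz: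
  fixes f :: "real \<Rightarrow> real"
  assumes f: "f integrable_on {u..v}" and M: "\<And>x. x \<in> {u..v} \<Longrightarrow> \<bar>f x\<bar> \<le> M"
    and p: "p \<in> {u..v}" and q: "q \<in> {u..v}"
  shows "\<bar>integral {u..p} f - integral {u..q} f\<bar> \<le> M * \<bar>p - q\<bar>"
proof -
  have *: "\<bar>integral {u..p} f - integral {u..q} f\<bar> \<le> M * \<bar>p - q\<bar>"
    if "p \<le> q" "p \<in> {u..v}" "q \<in> {u..v}" for p q
  proof -
    have "integral {u..p} f + integral {p..q} f = integral {u..q} f"
      using that f
      by (intro Henstock_Kurzweil_Integration.integral_combine)
         (auto intro: integrable_on_subinterval)
    moreover have "norm (integral {p..q} f) \<le> M * content {p..q}"
    proof (rule has_integral_bound_real[of _ "{}"])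
      show "0 \<le> M" using M[OF that(2)] by simp
      show "(f has_integral integral {p..q} f) {p..q}"
        using f that by (intro integrable_integral) (auto intro: integrable_on_subinterval)
      show "norm (f x) \<le> M" if "x \<in> {p..q} - {}" for x
        using that \<open>p \<in> {u..v}\<close> \<open>q \<in> {u..v}\<close> M[of x] by simp
    qed simp
    ultimately show ?thesis using that by simp
  qed
  show ?thesis
    using *[OF _ p q] *[OF _ q p] by (cases "p \<le> q") (auto simp: abs_minus_commute)
qed

lemma integral_has_real_derivative_within:
  fixes f :: "real \<Rightarrow> real"
  assumes "f integrable_on {u..v}" "x \<in> {u..v} - discontinuities f {u..v}"
  shows "((\<lambda>x. integral {u..x} f) has_real_derivative f x) (at x within {u..v})"
  using integral_has_vector_derivative_continuous_at[OF assms(1), of x "{}"] assms(2)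
  by (simp add: discontinuities_def has_real_derivative_iff_has_vector_derivative)

section \<open>Substitution\<close>

lemma negligible_nonzero_derivative_preimage:
  fixes G :: "real \<Rightarrow> real"
  assumes "\<And>t. t \<in> S \<Longrightarrow> (G has_real_derivative g t) (at t within S)" and "negligible Z"
  shows "negligible {t \<in> S. g t \<noteq> 0 \<and> G t \<in> Z}" (is "negligible ?P")
proof (rule negligible_if_image_negligible)
  show "(G has_real_derivative g t) (at t within ?P)" if "t \<in> ?P" for t
    using that by (intro DERIV_subset[OF assms(1)]) auto
  show "negligible (G ` ?P)"
    by (rule negligible_subset[OF assms(2)]) auto
qed simp

text \<open>
  At a zero of \<open>g\<close> the boundedness of \<open>f\<close> alone forces continuity of the product; this is why
  the discontinuities of \<open>f\<close> matter only over points with \<open>g t \<noteq> 0\<close>.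
\<close>
lemma continuous_substitution_integrand:
  fixes f g G :: "real \<Rightarrow> real"
  assumes t: "t \<in> S" and g: "continuous (at t within S) g" and G: "continuous (at t within S) G"
    and M: "\<And>s. s \<in> S \<Longrightarrow> \<bar>f (G s)\<bar> \<le> M"
    and f: "g t = 0 \<or> continuous (at (G t) within G ` S) f"
  shows "continuous (at t within S) (\<lambda>s. f (G s) * g s)"
  using f
proof
  assume 0: "g t = 0"
  have "((\<lambda>s. f (G s) * g s) \<longlongrightarrow> 0) (at t within S)"
  proof (rule Lim_null_comparison)
    show "\<forall>\<^sub>F s in at t within S. norm (f (G s) * g s) \<le> M * \<bar>g s\<bar>"
      unfolding eventually_at_filter
      by (intro always_eventually allI impI) (simp add: abs_mult M mult_right_mono)
    have "(g \<longlongrightarrow> 0) (at t within S)"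
      using g 0 by (simp add: continuous_within)
    then show "((\<lambda>s. M * \<bar>g s\<bar>) \<longlongrightarrow> 0) (at t within S)"
      by (intro tendsto_mult_right_zero tendsto_rabs_zero)
  qed
  then show ?thesis by (simp add: continuous_within 0)
next
  assume "continuous (at (G t) within G ` S) f"
  then have "continuous (at t within S) (f \<circ> G)"
    by (rule continuous_within_compose[OF G])
  then show ?thesis using g by (simp add: o_def continuous_mult)
qed

text \<open>
  A nonzero derivative at an interior point makes \<open>G\<close> map every neighbourhood of \<open>t\<close> onto a
  neighbourhood of \<open>G t\<close>. Every \<open>y\<close> near \<open>G t\<close> is therefore \<open>G s\<close> with \<open>s\<close> near \<open>t\<close>, and the continuity of
  \<open>f \<circ> G\<close> at \<open>t\<close> passes to \<open>f\<close>.
\<close>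
lemma continuous_at_image_of_open_mapping:
  fixes f G :: "real \<Rightarrow> real"
  assumes G: "continuous_on {a..b} G" and t: "t \<in> {a<..<b}"
    and der: "(G has_real_derivative d) (at t)" and d: "d \<noteq> 0"
    and fG: "continuous (at t within {a..b}) (\<lambda>s. f (G s))"
  shows "continuous (at (G t)) f"
  unfolding continuous_within_eps_delta
proof (intro allI impI)
  fix e :: real assume "e > 0"
  then obtain r where r: "r > 0"
    and close: "\<And>s. s \<in> {a..b} \<Longrightarrow> dist s t < r \<Longrightarrow> dist (f (G s)) (f (G t)) < e"
    using fG unfolding continuous_within_eps_delta by blast
  let ?T = "{a<..<b} \<inter> ball t r"
  have "G t \<in> interior (G ` ?T)"
  proof (rule sussmann_open_mapping)
    show "open {a<..<b}" "t \<in> {a<..<b}" "?T \<subseteq> {a<..<b}" using t by auto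
    show "continuous_on {a<..<b} G"
      using G by (rule continuous_on_subset) auto
    show "(G has_derivative (*) d) (at t)"
      using der by (simp add: has_field_derivative_def)
    show "bounded_linear ((*) (inverse d))" by (rule bounded_linear_mult_right)
    show "(*) d \<circ> (*) (inverse d) = id" using d by (auto simp: fun_eq_iff)
    show "t \<in> interior ?T" using t r by (simp add: interior_open open_Int)
  qed
  then obtain q where q: "q > 0" "ball (G t) q \<subseteq> G ` ?T"
    by (auto simp: mem_interior)
  show "\<exists>q>0. \<forall>y\<in>UNIV. dist y (G t) < q \<longrightarrow> dist (f y) (f (G t)) < e"
  proof (intro exI[of _ q] conjI ballI impI)
    fix y assume "dist y (G t) < q"
    then have "y \<in> G ` ?T" using q by (auto simp: dist_commute)
    then show "dist (f y) (f (G t)) < e" using close by (auto simp: dist_commute)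
  qed (rule q)
qed

lemma continuous_factor:
  fixes k g :: "real \<Rightarrow> real"
  assumes g: "continuous (at t within S) g" "g t \<noteq> 0"
    and k: "continuous (at t within S) (\<lambda>s. k s * g s)"
  shows "continuous (at t within S) k"
proof -
  have "continuous (at t within S) (\<lambda>s. k s * g s / g s)"
    using k g unfolding continuous_within by (intro tendsto_divide) auto
  moreover have "\<forall>\<^sub>F s in at t within S. k s * g s / g s = k s"
  proof -
    have "\<forall>\<^sub>F s in at t within S. g s \<noteq> 0"
      using g by (intro tendsto_imp_eventually_ne[where c = "g t"]) (auto simp: continuous_within)
    then show ?thesis by eventually_elim simp
  qed
  ultimately show ?thesis
    using g(2) by (simp add: continuous_within tendsto_cong)
qed

text \<open>
  The points outside of which \<open>(f \<circ> G) g\<close> is continuous and is the derivative of \<open>F \<circ> G\<close>, for \<open>F\<close> an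
  indefinite integral of \<open>f\<close>.
\<close>
definition substitution_exceptions ::
    "(real \<Rightarrow> real) \<Rightarrow> (real \<Rightarrow> real) \<Rightarrow> (real \<Rightarrow> real) \<Rightarrow> real set \<Rightarrow> real set" where
  "substitution_exceptions f G g S = discontinuities g S \<union>
     {t \<in> S - discontinuities g S. g t \<noteq> 0 \<and> G t \<in> discontinuities f (G ` S)}"

lemma negligible_substitution_exceptions:
  fixes G g f :: "real \<Rightarrow> real"
  assumes G: "\<And>t. t \<in> {a..b} - discontinuities g {a..b} \<Longrightarrow>
      (G has_real_derivative g t) (at t within {a..b})"
    and g: "negligible (discontinuities g {a..b})"
    and f: "negligible (discontinuities f (G ` {a..b}))"
  shows "negligible (substitution_exceptions f G g {a..b})"
  unfolding substitution_exceptions_def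
proof (intro negligible_Un g negligible_nonzero_derivative_preimage f)
  fix t assume t: "t \<in> {a..b} - discontinuities g {a..b}"
  show "(G has_real_derivative g t) (at t within {a..b} - discontinuities g {a..b})"
    by (rule DERIV_subset[OF G[OF t]]) auto
qed

lemma discontinuities_integrand_subset_exceptions:
  fixes G g f :: "real \<Rightarrow> real"
  assumes G: "continuous_on {a..b} G"
    and M: "\<And>t. t \<in> {a..b} \<Longrightarrow> \<bar>f (G t)\<bar> \<le> M"
  shows "discontinuities (\<lambda>t. f (G t) * g t) {a..b} \<subseteq> substitution_exceptions f G g {a..b}"
proof
  fix t assume t: "t \<in> discontinuities (\<lambda>t. f (G t) * g t) {a..b}"
  have "g t \<noteq> 0" "\<not> continuous (at (G t) within G ` {a..b}) f" if "t \<notin> discontinuities g {a..b}"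
    using continuous_substitution_integrand[of t "{a..b}" g G f M] t that G M
    by (auto simp: discontinuities_def continuous_on_eq_continuous_within)
  with t show "t \<in> substitution_exceptions f G g {a..b}"
    by (auto simp: discontinuities_def substitution_exceptions_def)
qed

text \<open>
  This controls \<open>f\<close> by means of \<open>(f \<circ> G) g\<close>: over an interior point where \<open>g\<close> and the product are continuous
  and \<open>g\<close> does not vanish, division by \<open>g\<close> and the open mapping argument give continuity of
  \<open>f\<close>. The end points are excluded because \<open>G\<close> need not be open there.
\<close>
lemma discontinuities_image_subset:
  fixes G g f :: "real \<Rightarrow> real"
  assumes G: "continuous_on {a..b} G"
    and der: "\<And>t. t \<in> {a..b} - discontinuities g {a..b} \<Longrightarrow>
      (G has_real_derivative g t) (at t within {a..b})"
  shows "discontinuities f (G ` {a..b}) \<subseteq>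
    G ` ({a, b} \<union> discontinuities g {a..b} \<union> discontinuities (\<lambda>t. f (G t) * g t) {a..b}) \<union>
    G ` {t \<in> {a..b} - discontinuities g {a..b}. g t = 0}" (is "_ \<subseteq> G ` ?E \<union> G ` ?Z")
proof
  fix x assume "x \<in> discontinuities f (G ` {a..b})"
  then obtain t where t: "t \<in> {a..b}" "x = G t" "\<not> continuous (at (G t) within G ` {a..b}) f"
    by (auto simp: discontinuities_def)
  have "t \<in> ?E \<union> ?Z"
  proof (rule ccontr)
    assume "t \<notin> ?E \<union> ?Z"
    then have good: "t \<in> {a<..<b}" "t \<notin> discontinuities g {a..b}" "g t \<noteq> 0"
      and cont: "continuous (at t within {a..b}) g"
        "continuous (at t within {a..b}) (\<lambda>t. f (G t) * g t)"
      using t(1) by (auto simp: discontinuities_def)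
    have "(G has_real_derivative g t) (at t)"
      using der[of t] good at_within_Icc_at[of a t b] by auto
    moreover have "continuous (at t within {a..b}) (\<lambda>s. f (G s))"
      by (rule continuous_factor[OF cont(1) good(3) cont(2)])
    ultimately have "continuous (at (G t)) f"
      using continuous_at_image_of_open_mapping[OF G good(1) _ good(3)] by blast
    then show False
      using t(3) continuous_at_imp_continuous_at_within by blast
  qed
  then show "x \<in> G ` ?E \<union> G ` ?Z" using t(2) by blast
qed

text \<open>
  The function \<open>F (G t) - H t\<close>, with \<open>F\<close> and \<open>H\<close> indefinite integrals of \<open>f\<close> and of \<open>(f \<circ> G) g\<close>, is
  Lipschitz and has derivative \<open>0\<close> almost everywhere, so it is constant.
\<close>
lemma riemann_substitution:
  fixes G g f :: "real \<Rightarrow> real"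
  assumes "a \<le> b"
    and lip: "\<And>s t. s \<in> {a..b} \<Longrightarrow> t \<in> {a..b} \<Longrightarrow> \<bar>G s - G t\<bar> \<le> L * \<bar>s - t\<bar>"
    and der: "\<And>t. t \<in> {a..b} - discontinuities g {a..b} \<Longrightarrow>
      (G has_real_derivative g t) (at t within {a..b})"
    and g: "negligible (discontinuities g {a..b})"
    and img: "G ` {a..b} = {u..v}"
    and f: "f riemann_integrable_on {u..v}"
    and fg: "(\<lambda>t. f (G t) * g t) riemann_integrable_on {a..b}"
  shows "riemann_integral (G a) (G b) f = riemann_integral a b (\<lambda>t. f (G t) * g t)"
proof -
  let ?k = "\<lambda>t. f (G t) * g t"
  define F where "F x = integral {u..x} f" for x
  define H where "H t = integral {a..t} ?k" for t
  define N where "N = substitution_exceptions f G g {a..b}"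
  have GI: "G t \<in> {u..v}" if "t \<in> {a..b}" for t using img that by blast
  note intf = riemann_integral_eq_integral(2)[OF f]
  note intk = riemann_integral_eq_integral(2)[OF fg]
  obtain M where M: "\<And>x. x \<in> {u..v} \<Longrightarrow> \<bar>f x\<bar> \<le> M"
    using riemann_integrable_imp_bounded[OF f] unfolding bounded_iff by (metis imageI real_norm_def)
  obtain M' where M': "\<And>t. t \<in> {a..b} \<Longrightarrow> \<bar>?k t\<bar> \<le> M'"
    using riemann_integrable_imp_bounded[OF fg] unfolding bounded_iff by (metis imageI real_norm_def)
  have M0: "0 \<le> M" using M[OF GI[of a]] \<open>a \<le> b\<close> by simp
  have lipF: "\<bar>F (G s) - F (G t)\<bar> \<le> M * \<bar>G s - G t\<bar>" if "s \<in> {a..b}" "t \<in> {a..b}" for s t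
    unfolding F_def by (rule integral_Lipschitz[OF intf M GI[OF that(1)] GI[OF that(2)]])
  have lipH: "\<bar>H s - H t\<bar> \<le> M' * \<bar>s - t\<bar>" if "s \<in> {a..b}" "t \<in> {a..b}" for s t
    unfolding H_def by (rule integral_Lipschitz[OF intk M' that])
  have contG: "continuous_on {a..b} G"
  proof -
    have "\<bar>G s - G t\<bar> \<le> \<bar>L\<bar> * \<bar>s - t\<bar>" if "s \<in> {a..b}" "t \<in> {a..b}" for s t
      using lip[OF that] mult_right_mono[of L "\<bar>L\<bar>" "\<bar>s - t\<bar>"] by linarith
    then have "\<bar>L\<bar>-lipschitz_on {a..b} G"
      by (simp add: lipschitz_on_def dist_real_def)
    then show ?thesis by (rule lipschitz_on_continuous_on)
  qed
  have "F (G a) - H a = F (G b) - H b"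
  proof (rule Lipschitz_zero_derivative_ae_imp_constant[OF \<open>a \<le> b\<close>])
    show "negligible N"
      unfolding N_def using der g riemann_integrable_imp_negligible_discontinuities[OF f]
      by (intro negligible_substitution_exceptions) (auto simp: img)
    show "\<bar>F (G s) - H s - (F (G t) - H t)\<bar> \<le> (M * L + M') * \<bar>s - t\<bar>"
      if "s \<in> {a..b}" "t \<in> {a..b}" for s t
    proof -
      have "M * \<bar>G s - G t\<bar> \<le> M * (L * \<bar>s - t\<bar>)"
        using lip[OF that] M0 by (intro mult_left_mono)
      then show ?thesis
        using lipF[OF that] lipH[OF that] by (simp add: algebra_simps)
    qed
    show "((\<lambda>t. F (G t) - H t) has_real_derivative 0) (at t within {a..b})"
      if t: "t \<in> {a..b} - N" for t
    proof -
      have tg: "t \<in> {a..b} - discontinuities g {a..b}"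
        using t by (auto simp: N_def substitution_exceptions_def)
      have "discontinuities ?k {a..b} \<subseteq> N"
        unfolding N_def by (intro discontinuities_integrand_subset_exceptions[OF contG]) (use M GI in blast)
      then have derH: "(H has_real_derivative ?k t) (at t within {a..b})"
        unfolding H_def using t by (intro integral_has_real_derivative_within[OF intk]) auto
      have "((\<lambda>t. F (G t)) has_real_derivative f (G t) * g t) (at t within {a..b})"
        \<comment> \<open>The chain rule needs \<open>F\<close> to be differentiable at \<open>G t\<close>, which may fail if \<open>g t = 0\<close>;
          then the Lipschitz bound on \<open>F\<close> shows directly that the derivative is \<open>0\<close>.\<close>
      proof (cases "g t = 0")
        case True
        have "((\<lambda>s. (G s - G t) / (s - t)) \<longlongrightarrow> 0) (at t within {a..b})"
          using der[OF tg] True by (simp add: has_field_derivative_iff)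
        then have lim: "((\<lambda>s. M * \<bar>(G s - G t) / (s - t)\<bar>) \<longlongrightarrow> 0) (at t within {a..b})"
          by (intro tendsto_mult_right_zero tendsto_rabs_zero)
        have "((\<lambda>s. (F (G s) - F (G t)) / (s - t)) \<longlongrightarrow> 0) (at t within {a..b})"
        proof (rule Lim_null_comparison[OF _ lim])
          have "norm ((F (G s) - F (G t)) / (s - t)) \<le> M * \<bar>(G s - G t) / (s - t)\<bar>"
            if "s \<in> {a..b}" for s
            using lipF[OF that, of t] tg by (simp add: abs_divide divide_right_mono)
          then show "\<forall>\<^sub>F s in at t within {a..b}. norm ((F (G s) - F (G t)) / (s - t))
              \<le> M * \<bar>(G s - G t) / (s - t)\<bar>"
            unfolding eventually_at_filter by (intro always_eventually) blast
        qed
        then show ?thesis using True by (simp add: has_field_derivative_iff)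
      next
        case False
        then have "G t \<notin> discontinuities f (G ` {a..b})"
          using t by (auto simp: N_def substitution_exceptions_def)
        then have "(F has_real_derivative f (G t)) (at (G t) within G ` {a..b})"
          unfolding F_def img using GI tg by (intro integral_has_real_derivative_within[OF intf]) auto
        then show ?thesis
          using DERIV_image_chain[OF _ der[OF tg]] by (simp add: o_def)
      qed
      from DERIV_diff[OF this derH] show ?thesis by simp
    qed
  qed
  moreover have "H a = 0" by (simp add: H_def)
  ultimately show ?thesis
    using riemann_integral_eq_diff[OF f GI[of a] GI[of b]] riemann_integral_eq_integral(1)[OF fg] \<open>a \<le> b\<close>
    by (simp add: F_def H_def)
qed

theorem theorem1p3:
  fixes a b c :: real and f g G :: "real \<Rightarrow> real"
  assumes "a < b"
    and "g riemann_integrable_on {a..b}"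
    and "\<And>t. t \<in> {a..b} \<Longrightarrow> G t = c + riemann_integral a t g"
    and "bounded (f ` G ` {a..b})"
  shows "(f riemann_integrable_on (G ` {a..b}) \<longleftrightarrow>
            (\<lambda>t. f (G t) * g t) riemann_integrable_on {a..b}) \<and>
         (f riemann_integrable_on (G ` {a..b}) \<longrightarrow>
            riemann_integral (G a) (G b) f = riemann_integral a b (\<lambda>t. f (G t) * g t))"
proof -
  let ?k = "\<lambda>t. f (G t) * g t"
  have ab: "a \<le> b" using assms(1) by simp
  note intg = riemann_integral_eq_integral(2)[OF assms(2)]
  obtain L where L: "\<And>t. t \<in> {a..b} \<Longrightarrow> \<bar>g t\<bar> \<le> L"
    using riemann_integrable_imp_bounded[OF assms(2)] unfolding bounded_iff
    by (metis imageI real_norm_def)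
  obtain M where M: "\<And>t. t \<in> {a..b} \<Longrightarrow> \<bar>f (G t)\<bar> \<le> M"
    using assms(4) unfolding bounded_iff by (metis imageI real_norm_def)
  have G: "G t = c + integral {a..t} g" if "t \<in> {a..b}" for t
    using assms(3)[OF that] riemann_integral_eq_diff[OF assms(2) _ that, of a] ab by simp
  have lip: "\<bar>G s - G t\<bar> \<le> L * \<bar>s - t\<bar>" if "s \<in> {a..b}" "t \<in> {a..b}" for s t
    using integral_Lipschitz[OF intg L that] G that by simp
  have negg: "negligible (discontinuities g {a..b})"
    using assms(2) by (rule riemann_integrable_imp_negligible_discontinuities)
  have der: "(G has_real_derivative g t) (at t within {a..b})"
    if t: "t \<in> {a..b} - discontinuities g {a..b}" for t
  proof (rule has_field_derivative_transform_within[OF _ zero_less_one])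
    show "((\<lambda>t. c + integral {a..t} g) has_real_derivative g t) (at t within {a..b})"
      using DERIV_add[OF DERIV_const integral_has_real_derivative_within[OF intg t], of c] by simp
  qed (use t G in auto)
  have "continuous_on {a..b} (\<lambda>t. c + integral {a..t} g)"
    using intg by (intro continuous_intros indefinite_integral_continuous_1)
  then have contG: "continuous_on {a..b} G"
    by (rule continuous_on_eq) (simp add: G)
  obtain u v where img: "G ` {a..b} = {u..v}" and uv: "u \<le> v"
    using continuous_image_closed_interval[OF ab contG] by blast
  have fwd: "?k riemann_integrable_on {a..b}" if f: "f riemann_integrable_on {u..v}"
    unfolding riemann_integrable_iff[OF ab]
  proof
    have "norm (?k t) \<le> M * L" if "t \<in> {a..b}" for t
      using M[OF that] L[OF that] by (simp add: abs_mult mult_mono)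
    then show "bounded (?k ` {a..b})" unfolding bounded_iff by blast
    show "negligible (discontinuities ?k {a..b})"
    proof (rule negligible_subset)
      show "discontinuities ?k {a..b} \<subseteq> substitution_exceptions f G g {a..b}"
        using contG M by (rule discontinuities_integrand_subset_exceptions)
      have "negligible (discontinuities f (G ` {a..b}))"
        using riemann_integrable_imp_negligible_discontinuities[OF f] by (simp add: img)
      then show "negligible (substitution_exceptions f G g {a..b})"
        by (rule negligible_substitution_exceptions[OF _ negg, rotated]) (rule der)
    qed
  qed
  have bwd: "f riemann_integrable_on {u..v}" if k: "?k riemann_integrable_on {a..b}"
    unfolding riemann_integrable_iff[OF uv]
  proof
    show "bounded (f ` {u..v})" using assms(4) by (simp add: img)
    let ?E = "{a, b} \<union> discontinuities g {a..b} \<union> discontinuities ?k {a..b}"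
    let ?Z = "{t \<in> {a..b} - discontinuities g {a..b}. g t = 0}"
    have E: "?E \<subseteq> {a..b}" using ab by (auto simp: discontinuities_def)
    have "negligible (G ` ?E)"
    proof (rule negligible_Lipschitz_image)
      show "negligible ?E"
        using negg riemann_integrable_imp_negligible_discontinuities[OF k] by simp
      show "\<bar>G s - G t\<bar> \<le> L * \<bar>s - t\<bar>" if "s \<in> ?E" "t \<in> ?E" for s t
        by (rule lip[OF subsetD[OF E that(1)] subsetD[OF E that(2)]])
    qed
    moreover have "negligible (G ` ?Z)"
    proof (rule negligible_image_of_zero_derivative)
      fix t assume "t \<in> ?Z"
      then have t: "t \<in> {a..b} - discontinuities g {a..b}" "g t = 0" by auto
      have "(G has_real_derivative g t) (at t within ?Z)"
        by (rule DERIV_subset[OF der[OF t(1)]]) auto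
      then show "(G has_real_derivative 0) (at t within ?Z)"
        unfolding t(2) .
    qed
    moreover have "discontinuities f {u..v} \<subseteq> G ` ?E \<union> G ` ?Z"
      unfolding img[symmetric] by (rule discontinuities_image_subset[OF contG]) (rule der)
    ultimately show "negligible (discontinuities f {u..v})"
      by (rule negligible_subset[OF negligible_Un])
  qed
  have "riemann_integral (G a) (G b) f = riemann_integral a b ?k" if "f riemann_integrable_on {u..v}"
    by (rule riemann_substitution[OF ab _ _ negg img that fwd[OF that]]) (rule lip der | assumption)+
  then show ?thesis
    unfolding img using fwd bwd by blast
qed

end
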